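(* Let $A\in\mathbb{C}^{n\times n}$ have singular value decomposition $A = U\Sigma V^*$, with $U,V$ unitary and $\Sigma=\operatorname{diag}(\sigma_1,\dots,\sigma_n)$, $\sigma_1\geq\sigma_2\geq\dots\geq\sigma_n\geq 0$, and let $k$ be an integer with $0\leq k<n$. Let $k_+$ (resp. $k_-$) be the number of singular values of $A$ strictly greater (resp. strictly smaller) than $1$. Let $\hat A= U \widehat{\Sigma} V^*$, where $\widehat{\Sigma}$ is the diagonal matrix with diagonal elements \[ \hat{\sigma}_i = \begin{cases} 1 & \text{if } k< i \leq k_+ \text{ or } n-k_- < i \leq n-k,\\ \sigma_i & \text{otherwise.} \end{cases} \] Then $\hat A\in\mathcal{U}_k$ attains the minimum of $\|A-X\|_2$ over $X\in\mathcal{U}_k$, and \[ \min_{X \in \mathcal{U}_k} \|A - X\|_2 = \|A- \hat A\|_2= \max\{0,\ \sigma_{k+1} - 1,\ 1-\sigma_{n-k}\}. \]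
   Context: $\mathcal{U}_k$ is the set of unitary-plus-rank-$k$ matrices: $X\in\mathbb{C}^{n\times n}$ belongs to $\mathcal{U}_k$ if and only if there exist a unitary matrix $Q\in\mathbb{C}^{n\times n}$ and matrices $G,B\in\mathbb{C}^{n\times k}$ such that $X = Q + GB^*$. $\|\cdot\|_2$ is the spectral norm. Singular values are counted with multiplicity. *)

theory Defs
  imports "HOL-Analysis.L2_Norm" "Jordan_Normal_Form.Schur_Decomposition"
begin

definition euclidean_norm :: "complex vec \<Rightarrow> real" where
  "euclidean_norm x = L2_set (\<lambda>i. cmod (x $ i)) {..<dim_vec x}"

(* The unit ball instead of the unit sphere, so that the set is nonempty also for dim_col M = 0. *)
definition spectral_norm :: "complex mat \<Rightarrow> real" where
  "spectral_norm M =
     Sup {euclidean_norm (M *\<^sub>v x) | x. x \<in> carrier_vec (dim_col M) \<and> euclidean_norm x \<le> 1}"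

definition unitary_mats :: "nat \<Rightarrow> complex mat set" where
  "unitary_mats n =
     {Q \<in> carrier_mat n n. mat_adjoint Q * Q = 1\<^sub>m n \<and> Q * mat_adjoint Q = 1\<^sub>m n}"

definition unitary_plus_rank :: "nat \<Rightarrow> nat \<Rightarrow> complex mat set" where
  "unitary_plus_rank n k =
     {Q + G * mat_adjoint B | Q G B.
        Q \<in> unitary_mats n \<and> G \<in> carrier_mat n k \<and> B \<in> carrier_mat n k}"

(* The sequence s is indexed from 1, whereas matrix entries are indexed from 0. *)
definition real_diag :: "nat \<Rightarrow> (nat \<Rightarrow> real) \<Rightarrow> complex mat" where
  "real_diag n s = mat_diag n (\<lambda>i. complex_of_real (s (Suc i)))"

definition is_svd :: "nat \<Rightarrow> complex mat \<Rightarrow> complex mat \<Rightarrow> (nat \<Rightarrow> real) \<Rightarrow> complex mat \<Rightarrow> bool" where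
  "is_svd n A U s V \<longleftrightarrow>
     U \<in> unitary_mats n \<and> V \<in> unitary_mats n \<and>
     (\<forall>i j. 1 \<le> i \<and> i \<le> j \<and> j \<le> n \<longrightarrow> s j \<le> s i) \<and>
     (\<forall>i\<in>{1..n}. 0 \<le> s i) \<and>
     A = U * real_diag n s * mat_adjoint V"

(* Counting indices rather than values accounts for multiplicities. *)
definition num_above_one :: "nat \<Rightarrow> (nat \<Rightarrow> real) \<Rightarrow> nat" where
  "num_above_one n s = card {i \<in> {1..n}. 1 < s i}"

definition num_below_one :: "nat \<Rightarrow> (nat \<Rightarrow> real) \<Rightarrow> nat" where
  "num_below_one n s = card {i \<in> {1..n}. s i < 1}"

(* The truncated subtractions are exact for k \<le> n, as num_below_one n s \<le> n always. *)
definition clipped :: "nat \<Rightarrow> nat \<Rightarrow> (nat \<Rightarrow> real) \<Rightarrow> nat \<Rightarrow> real" where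
  "clipped n k s i =
     (if k < i \<and> i \<le> num_above_one n s \<or> n - num_below_one n s < i \<and> i \<le> n - k
      then 1 else s i)"

end

theory Submission
  imports Defs
begin

text \<open>
The number \<open>M = max {0, \<sigma>\<^sub>k\<^sub>+\<^sub>1 - 1, 1 - \<sigma>\<^sub>n\<^sub>-\<^sub>k}\<close> bounds the distance from \<open>A\<close> to every
member of \<open>\<U>\<^sub>k\<close> from below, and \<open>Ahat\<close> is a member of \<open>\<U>\<^sub>k\<close> whose distance to \<open>A\<close> is at most \<open>M\<close>; all three claims follow.

Lower bound (\<open>distance_unitary_plus_rank_ge\<close>). A matrix \<open>X = Q + G B\<^sup>*\<close> acts as the isometry \<open>Q\<close> on
the kernel of \<open>B\<^sup>*\<close>, which has codimension at most \<open>k\<close> and hence meets the span of any \<open>k + 1\<close>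
right singular vectors of \<open>A\<close> in some \<open>x \<noteq> 0\<close>. If these belong to the \<open>k + 1\<close> largest
singular values, then \<open>A\<close> stretches \<open>x\<close> by at least \<open>\<sigma>\<^sub>k\<^sub>+\<^sub>1\<close>; if they belong to the \<open>k + 1\<close>
smallest ones, by at most \<open>\<sigma>\<^sub>n\<^sub>-\<^sub>k\<close>. Since \<open>X\<close> preserves the length of \<open>x\<close>, the reverse triangle
inequality bounds \<open>A - X\<close> from below at \<open>x\<close>.

Membership (\<open>real_diag_in_unitary_plus_rank\<close>). As \<open>\<U>\<^sub>k\<close> is invariant under unitary
equivalence, it suffices to treat the clipped diagonal. At most \<open>k\<close> of its entries exceed 1 and at
most \<open>k\<close> are below 1, so spending one rank on each entry different from 1 may need rank \<open>2 k\<close>.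
What saves a factor of two is that \<open>diag(x, y)\<close> with \<open>x \<ge> 1 \<ge> y \<ge> 0\<close> is already a plane
rotation plus a single rank-one matrix. Pairing each position with its mirror image
therefore handles an entry above 1 and an entry below 1 at the cost of one rank.

Upper bound. The difference \<open>A - Ahat\<close> is unitarily equivalent to the diagonal matrix of the
changes made by clipping, and monotonicity of the singular values bounds each of them by \<open>M\<close>.
\<close>

section \<open>Adjoints and unitary matrices\<close>

lemma dim_mat_adjoint [simp]:
  "dim_row (mat_adjoint A) = dim_col A" "dim_col (mat_adjoint A) = dim_row A"
  by (simp_all add: mat_adjoint_def)

lemma mat_adjoint_carrier [simp]:
  "A \<in> carrier_mat m n \<Longrightarrow> mat_adjoint A \<in> carrier_mat n m"
  by (rule carrier_matI) auto

lemma mat_adjoint_index [simp]: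
  fixes A :: "complex mat"
  assumes "i < dim_col A" "j < dim_row A"
  shows "mat_adjoint A $$ (i, j) = cnj (A $$ (j, i))"
  using assms by (simp add: mat_adjoint_def mat_of_rows_def)

lemma mat_adjoint_mat_adjoint [simp]:
  fixes A :: "complex mat"
  shows "mat_adjoint (mat_adjoint A) = A"
  by (rule eq_matI) auto

lemma mat_adjoint_mult:
  fixes A B :: "complex mat"
  assumes "A \<in> carrier_mat m n" "B \<in> carrier_mat n p"
  shows "mat_adjoint (A * B) = mat_adjoint B * mat_adjoint A"
  using assms by (intro eq_matI) (auto simp: scalar_prod_def mult.commute intro!: sum.cong)

lemma unitary_matsD:
  assumes "Q \<in> unitary_mats n"
  shows "Q \<in> carrier_mat n n" "mat_adjoint Q * Q = 1\<^sub>m n" "Q * mat_adjoint Q = 1\<^sub>m n"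
  using assms by (auto simp: unitary_mats_def)

lemma unitary_matsI:
  fixes Q :: "complex mat"
  assumes "Q \<in> carrier_mat n n" "mat_adjoint Q * Q = 1\<^sub>m n"
  shows "Q \<in> unitary_mats n"
  using assms mat_mult_left_right_inverse[of "mat_adjoint Q" n Q]
  by (simp add: unitary_mats_def)

lemma mat_adjoint_unitary:
  "Q \<in> unitary_mats n \<Longrightarrow> mat_adjoint Q \<in> unitary_mats n"
  by (auto simp: unitary_mats_def)

lemma unitary_mats_mult:
  assumes P: "P \<in> unitary_mats n" and Q: "Q \<in> unitary_mats n"
  shows "P * Q \<in> unitary_mats n"
proof (rule unitary_matsI)
  note [simp] = unitary_matsD[OF P] unitary_matsD[OF Q]
  show "P * Q \<in> carrier_mat n n"
    by (rule mult_carrier_mat[of _ n n]) simp_all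
  have "mat_adjoint (P * Q) * (P * Q) = mat_adjoint Q * mat_adjoint P * (P * Q)"
    by (simp add: mat_adjoint_mult[of _ n n _ n])
  also have "\<dots> = mat_adjoint Q * (mat_adjoint P * (P * Q))"
    by (rule assoc_mult_mat[of _ n n _ n _ n]) (simp_all add: mult_carrier_mat[of _ n n])
  also have "mat_adjoint P * (P * Q) = mat_adjoint P * P * Q"
    by (rule assoc_mult_mat[symmetric, of _ n n _ n _ n]) simp_all
  also have "mat_adjoint Q * (mat_adjoint P * P * Q) = 1\<^sub>m n"
    by (simp add: left_mult_one_mat[of _ n n])
  finally show "mat_adjoint (P * Q) * (P * Q) = 1\<^sub>m n" .
qed

section \<open>Euclidean and spectral norm\<close>

lemma euclidean_norm_nonneg [simp]: "0 \<le> euclidean_norm x"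
  by (simp add: euclidean_norm_def L2_set_nonneg)

lemma euclidean_norm_zero_vec [simp]: "euclidean_norm (0\<^sub>v n) = 0"
  by (simp add: euclidean_norm_def L2_set_def)

lemma euclidean_norm_pos:
  assumes "x \<in> carrier_vec n" "x \<noteq> 0\<^sub>v n"
  shows "0 < euclidean_norm x"
proof -
  obtain i where "i < n" "x $ i \<noteq> 0"
    using assms by (metis carrier_vecD eq_vecI index_zero_vec)
  then have "euclidean_norm x \<noteq> 0"
    using assms by (auto simp: euclidean_norm_def L2_set_eq_0_iff)
  then show ?thesis
    using euclidean_norm_nonneg[of x] by linarith
qed

lemma euclidean_norm_smult:
  "euclidean_norm (c \<cdot>\<^sub>v x) = cmod c * euclidean_norm x"
  by (auto simp: euclidean_norm_def L2_set_right_distrib norm_mult intro!: L2_set_cong)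

lemma of_real_euclidean_norm_squared:
  "complex_of_real ((euclidean_norm x)\<^sup>2) = x \<bullet>c x"
  by (simp add: euclidean_norm_def L2_set_def sum_nonneg scalar_prod_def atLeast0LessThan
      complex_norm_square[symmetric])

lemma mult_mat_vec_cscalar_prod:
  fixes A :: "complex mat"
  assumes "A \<in> carrier_mat m n" "x \<in> carrier_vec n" "y \<in> carrier_vec m"
  shows "(A *\<^sub>v x) \<bullet>c y = x \<bullet>c (mat_adjoint A *\<^sub>v y)"
proof -
  have "(A *\<^sub>v x) \<bullet>c y = (\<Sum>i<m. \<Sum>j<n. A $$ (i, j) * x $ j * cnj (y $ i))"
    using assms by (auto simp: scalar_prod_def atLeast0LessThan sum_distrib_right)
  also have "\<dots> = (\<Sum>j<n. \<Sum>i<m. A $$ (i, j) * x $ j * cnj (y $ i))"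
    by (rule sum.swap)
  also have "\<dots> = x \<bullet>c (mat_adjoint A *\<^sub>v y)"
    using assms
    by (auto simp: scalar_prod_def atLeast0LessThan sum_distrib_left ac_simps intro!: sum.cong)
  finally show ?thesis .
qed

lemma euclidean_norm_unitary:
  assumes Q: "Q \<in> unitary_mats n" and x: "x \<in> carrier_vec n"
  shows "euclidean_norm (Q *\<^sub>v x) = euclidean_norm x"
proof -
  note [simp] = unitary_matsD[OF Q] x
  have "mat_adjoint Q *\<^sub>v (Q *\<^sub>v x) = mat_adjoint Q * Q *\<^sub>v x"
    by (rule assoc_mult_mat_vec[symmetric, of _ n n _ n]) simp_all
  then have "(Q *\<^sub>v x) \<bullet>c (Q *\<^sub>v x) = x \<bullet>c x"
    by (simp add: mult_mat_vec_cscalar_prod[of _ n n] mult_mat_vec_carrier[of _ n n]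
        one_mult_mat_vec[of _ n])
  then have "complex_of_real ((euclidean_norm (Q *\<^sub>v x))\<^sup>2) = complex_of_real ((euclidean_norm x)\<^sup>2)"
    by (simp only: of_real_euclidean_norm_squared)
  then have "(euclidean_norm (Q *\<^sub>v x))\<^sup>2 = (euclidean_norm x)\<^sup>2"
    by (simp only: of_real_eq_iff)
  then show ?thesis
    by simp
qed

lemma euclidean_norm_triangle:
  assumes "x \<in> carrier_vec n" "y \<in> carrier_vec n"
  shows "euclidean_norm (x + y) \<le> euclidean_norm x + euclidean_norm y"
proof -
  have "euclidean_norm (x + y) \<le> L2_set (\<lambda>i. cmod (x $ i) + cmod (y $ i)) {..<n}"
    using assms by (auto simp: euclidean_norm_def intro!: L2_set_mono norm_triangle_ineq)
  also have "\<dots> \<le> euclidean_norm x + euclidean_norm y"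
    using assms by (auto simp: euclidean_norm_def intro!: L2_set_triangle_ineq)
  finally show ?thesis .
qed

lemma euclidean_norm_minus:
  assumes "x \<in> carrier_vec n" "y \<in> carrier_vec n"
  shows "\<bar>euclidean_norm x - euclidean_norm y\<bar> \<le> euclidean_norm (x - y)"
proof -
  have "x - y + y = x" "(- 1) \<cdot>\<^sub>v (x - y) + x = y"
    using assms by auto
  then have "euclidean_norm x \<le> euclidean_norm (x - y) + euclidean_norm y"
    "euclidean_norm y \<le> euclidean_norm ((- 1) \<cdot>\<^sub>v (x - y)) + euclidean_norm x"
    using assms euclidean_norm_triangle[of "x - y" n y]
      euclidean_norm_triangle[of "(- 1) \<cdot>\<^sub>v (x - y)" n x] by auto
  then show ?thesis
    by (simp add: euclidean_norm_smult)
qed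

text \<open>
A supremum of reals has its expected properties only for a bounded set. On the unit ball every
coordinate has modulus at most 1, so the sum of the moduli of all entries of the matrix is a bound.
\<close>

lemma bdd_above_spectral_norm:
  "bdd_above {euclidean_norm (M *\<^sub>v x) | x. x \<in> carrier_vec (dim_col M) \<and> euclidean_norm x \<le> 1}"
proof (rule bdd_aboveI)
  fix r
  assume "r \<in> {euclidean_norm (M *\<^sub>v x) | x. x \<in> carrier_vec (dim_col M) \<and> euclidean_norm x \<le> 1}"
  then obtain x where x: "x \<in> carrier_vec (dim_col M)" "euclidean_norm x \<le> 1"
    and r: "r = euclidean_norm (M *\<^sub>v x)"
    by auto
  have entry: "cmod (x $ j) \<le> 1" if "j < dim_col M" for j
    using x that member_le_L2_set[of "{..<dim_col M}" j "\<lambda>i. cmod (x $ i)"]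
    by (auto simp: euclidean_norm_def)
  have "r \<le> (\<Sum>i<dim_row M. cmod ((M *\<^sub>v x) $ i))"
    unfolding r euclidean_norm_def dim_mult_mat_vec by (rule L2_set_le_sum) simp
  also have "\<dots> \<le> (\<Sum>i<dim_row M. \<Sum>j<dim_col M. cmod (M $$ (i, j)))"
  proof (rule sum_mono)
    fix i
    assume "i \<in> {..<dim_row M}"
    then have "cmod ((M *\<^sub>v x) $ i) = cmod (\<Sum>j<dim_col M. M $$ (i, j) * x $ j)"
      using x by (auto simp: scalar_prod_def atLeast0LessThan)
    also have "\<dots> \<le> (\<Sum>j<dim_col M. cmod (M $$ (i, j)))"
      using entry by (intro sum_norm_le) (auto simp: norm_mult mult_left_le)
    finally show "cmod ((M *\<^sub>v x) $ i) \<le> (\<Sum>j<dim_col M. cmod (M $$ (i, j)))" .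
  qed
  finally show "r \<le> (\<Sum>i<dim_row M. \<Sum>j<dim_col M. cmod (M $$ (i, j)))" .
qed

lemma euclidean_norm_le_spectral_norm_if_le_one:
  assumes "x \<in> carrier_vec (dim_col M)" "euclidean_norm x \<le> 1"
  shows "euclidean_norm (M *\<^sub>v x) \<le> spectral_norm M"
  unfolding spectral_norm_def using assms by (intro cSup_upper bdd_above_spectral_norm) auto

lemma spectral_norm_nonneg: "0 \<le> spectral_norm M"
  using euclidean_norm_le_spectral_norm_if_le_one[of "0\<^sub>v (dim_col M)" M]
    euclidean_norm_nonneg[of "M *\<^sub>v 0\<^sub>v (dim_col M)"]
  by (simp del: euclidean_norm_nonneg)

lemma euclidean_norm_le_spectral_norm:
  assumes M: "M \<in> carrier_mat m n" and x: "x \<in> carrier_vec n"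
  shows "euclidean_norm (M *\<^sub>v x) \<le> spectral_norm M * euclidean_norm x"
proof (cases "x = 0\<^sub>v n")
  case True
  then have "M *\<^sub>v x = 0\<^sub>v m"
    using M by (intro eq_vecI) auto
  then show ?thesis
    using True by simp
next
  case False
  then have pos: "0 < euclidean_norm x"
    using x by (rule euclidean_norm_pos[rotated])
  define c where "c = complex_of_real (1 / euclidean_norm x)"
  have c: "cmod c = 1 / euclidean_norm x"
    using pos by (simp add: c_def norm_divide)
  have "euclidean_norm (M *\<^sub>v (c \<cdot>\<^sub>v x)) \<le> spectral_norm M"
    using M x pos by (intro euclidean_norm_le_spectral_norm_if_le_one)
      (auto simp: euclidean_norm_smult c)
  then show ?thesis
    using pos by (simp add: mult_mat_vec[OF M x] euclidean_norm_smult c field_simps)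
qed

lemma spectral_norm_le:
  assumes "\<And>x. x \<in> carrier_vec (dim_col M) \<Longrightarrow> euclidean_norm x \<le> 1 \<Longrightarrow> euclidean_norm (M *\<^sub>v x) \<le> c"
  shows "spectral_norm M \<le> c"
proof -
  have "euclidean_norm (0\<^sub>v (dim_col M)) \<le> 1"
    by simp
  then show ?thesis
    unfolding spectral_norm_def using assms by (intro cSup_least) (blast intro: zero_carrier_vec, blast)
qed

section \<open>Real diagonal matrices\<close>

lemma real_diag_carrier [simp]: "real_diag n s \<in> carrier_mat n n"
  by (simp add: real_diag_def)

lemma real_diag_index [simp]:
  "i < n \<Longrightarrow> j < n \<Longrightarrow> real_diag n s $$ (i, j) = (if i = j then complex_of_real (s (Suc i)) else 0)"
  by (simp add: real_diag_def mat_diag_def)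

lemma real_diag_diff: "real_diag n (\<lambda>i. s i - t i) = real_diag n s - real_diag n t"
  by (rule eq_matI) (auto simp: carrier_matD[OF real_diag_carrier])

lemma real_diag_mult_vec_index:
  assumes "y \<in> carrier_vec n" "i < n"
  shows "(real_diag n s *\<^sub>v y) $ i = complex_of_real (s (Suc i)) * y $ i"
proof -
  have "(real_diag n s *\<^sub>v y) $ i =
      (\<Sum>j<n. (if i = j then complex_of_real (s (Suc i)) else 0) * y $ j)"
    using assms by (auto simp: scalar_prod_def atLeast0LessThan carrier_matD[OF real_diag_carrier]
        intro!: sum.cong)
  also have "\<dots> = complex_of_real (s (Suc i)) * y $ i"
    using assms by (simp add: if_distrib[of "\<lambda>a. a * _"] cong: if_cong)
  finally show ?thesis .
qed

lemma euclidean_norm_real_diag_mult_vec: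
  assumes "y \<in> carrier_vec n"
  shows "euclidean_norm (real_diag n s *\<^sub>v y) = L2_set (\<lambda>i. \<bar>s (Suc i)\<bar> * cmod (y $ i)) {..<n}"
  using assms carrier_matD[OF real_diag_carrier, of n s]
  by (auto simp: euclidean_norm_def real_diag_mult_vec_index norm_mult
      simp del: index_mult_mat_vec intro!: L2_set_cong)

lemma euclidean_norm_real_diag_le:
  assumes y: "y \<in> carrier_vec n" and "0 \<le> c"
    and s: "\<And>i. i < n \<Longrightarrow> y $ i \<noteq> 0 \<Longrightarrow> \<bar>s (Suc i)\<bar> \<le> c"
  shows "euclidean_norm (real_diag n s *\<^sub>v y) \<le> c * euclidean_norm y"
proof -
  have "\<bar>s (Suc i)\<bar> * cmod (y $ i) \<le> c * cmod (y $ i)" if "i < n" for i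
    using s[OF that] by (cases "y $ i = 0") (auto intro: mult_right_mono)
  then show ?thesis
    unfolding euclidean_norm_real_diag_mult_vec[OF y] using y \<open>0 \<le> c\<close>
    by (auto simp: euclidean_norm_def L2_set_right_distrib intro!: L2_set_mono)
qed

lemma euclidean_norm_real_diag_ge:
  assumes y: "y \<in> carrier_vec n" and "0 \<le> c"
    and s: "\<And>i. i < n \<Longrightarrow> y $ i \<noteq> 0 \<Longrightarrow> c \<le> \<bar>s (Suc i)\<bar>"
  shows "c * euclidean_norm y \<le> euclidean_norm (real_diag n s *\<^sub>v y)"
proof -
  have "c * cmod (y $ i) \<le> \<bar>s (Suc i)\<bar> * cmod (y $ i)" if "i < n" for i
    using s[OF that] by (cases "y $ i = 0") (auto intro: mult_right_mono)
  then show ?thesis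
    unfolding euclidean_norm_real_diag_mult_vec[OF y] using y \<open>0 \<le> c\<close>
    by (auto simp: euclidean_norm_def L2_set_right_distrib intro!: L2_set_mono)
qed

lemma spectral_norm_unitary_real_diag_le:
  assumes U: "U \<in> unitary_mats n" and V: "V \<in> unitary_mats n"
    and c: "0 \<le> c" and s: "\<And>i. i \<in> {1..n} \<Longrightarrow> \<bar>s i\<bar> \<le> c"
  shows "spectral_norm (U * real_diag n s * mat_adjoint V) \<le> c"
proof (rule spectral_norm_le)
  note [simp] = unitary_matsD(1)[OF U] unitary_matsD(1)[OF V]
  fix x :: "complex vec"
  assume "x \<in> carrier_vec (dim_col (U * real_diag n s * mat_adjoint V))"
  then have x [simp]: "x \<in> carrier_vec n"
    using carrier_matD(1)[OF unitary_matsD(1)[OF V]] by simp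
  assume le: "euclidean_norm x \<le> 1"
  define y where "y = mat_adjoint V *\<^sub>v x"
  have y: "y \<in> carrier_vec n"
    unfolding y_def by (rule mult_mat_vec_carrier[of _ n n]) simp_all
  have "U * real_diag n s * mat_adjoint V *\<^sub>v x = U *\<^sub>v (real_diag n s *\<^sub>v y)"
    by (simp add: y_def assoc_mult_mat_vec[of _ n n _ n] mult_carrier_mat[of _ n n]
        mult_mat_vec_carrier[of _ n n])
  moreover have "euclidean_norm (U *\<^sub>v (real_diag n s *\<^sub>v y)) = euclidean_norm (real_diag n s *\<^sub>v y)"
    using y by (intro euclidean_norm_unitary[OF U] mult_mat_vec_carrier[of _ n n]) simp_all
  moreover have "euclidean_norm (real_diag n s *\<^sub>v y) \<le> c * euclidean_norm y"
    using s by (intro euclidean_norm_real_diag_le y c) auto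
  moreover have "euclidean_norm y = euclidean_norm x"
    unfolding y_def by (rule euclidean_norm_unitary[OF mat_adjoint_unitary[OF V] x])
  ultimately show "euclidean_norm (U * real_diag n s * mat_adjoint V *\<^sub>v x) \<le> c"
    using le c mult_left_le[of "euclidean_norm x" c] by simp
qed

section \<open>Distance to unitary-plus-rank-k matrices\<close>

text \<open>
Padding with a zero row gives a square matrix of determinant zero, which has a kernel vector.
\<close>

lemma wide_matrix_kernel:
  fixes M :: "complex mat"
  assumes M: "M \<in> carrier_mat k (Suc k)"
  shows "\<exists>v. v \<in> carrier_vec (Suc k) \<and> v \<noteq> 0\<^sub>v (Suc k) \<and> M *\<^sub>v v = 0\<^sub>v k"
proof -
  define N where "N = Matrix.mat (Suc k) (Suc k) (\<lambda>(i, j). if i < k then M $$ (i, j) else 0)"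
  have N: "N \<in> carrier_mat (Suc k) (Suc k)"
    by (simp add: N_def)
  have "det N = 0"
  proof -
    have "row N k = 0\<^sub>v (Suc k)"
      by (rule eq_vecI) (auto simp: N_def)
    then show ?thesis
      using laplace_expansion_row[OF N, of k] by (simp add: N_def)
  qed
  then obtain v where v: "v \<in> carrier_vec (Suc k)" "v \<noteq> 0\<^sub>v (Suc k)" "N *\<^sub>v v = 0\<^sub>v (Suc k)"
    using det_0_iff_vec_prod_zero_field[OF N] by blast
  have "M *\<^sub>v v = 0\<^sub>v k"
  proof (rule eq_vecI)
    fix i
    assume "i < dim_vec (0\<^sub>v k)"
    then have i: "i < k"
      by simp
    then have "row M i = row N i"
      using M by (intro eq_vecI) (auto simp: N_def)
    then have "(M *\<^sub>v v) $ i = (N *\<^sub>v v) $ i"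
      using M N i by simp
    then show "(M *\<^sub>v v) $ i = 0\<^sub>v k $ i"
      using v i by simp
  qed (use M in simp)
  then show ?thesis
    using v by blast
qed

text \<open>
The preceding lemma, applied to a block of \<open>k + 1\<close> consecutive columns. In the coordinates given
by the right singular vectors, a support in such a block means membership in the span of
\<open>k + 1\<close> consecutive singular vectors.
\<close>

lemma kernel_vector_supported_on_interval:
  fixes M :: "complex mat"
  assumes M: "M \<in> carrier_mat k n" and mk: "m + k < n"
  shows "\<exists>y. y \<in> carrier_vec n \<and> y \<noteq> 0\<^sub>v n \<and> M *\<^sub>v y = 0\<^sub>v k \<and>
           (\<forall>i<n. y $ i \<noteq> 0 \<longrightarrow> m \<le> i \<and> i \<le> m + k)"
proof -
  define W where "W = Matrix.mat k (Suc k) (\<lambda>(i, j). M $$ (i, m + j))"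
  obtain v where v: "v \<in> carrier_vec (Suc k)" "v \<noteq> 0\<^sub>v (Suc k)" and Wv: "W *\<^sub>v v = 0\<^sub>v k"
    using wide_matrix_kernel[of W k] by (auto simp: W_def)
  define y where "y = vec n (\<lambda>i. if m \<le> i \<and> i \<le> m + k then v $ (i - m) else 0)"
  have y: "y \<in> carrier_vec n"
    by (simp add: y_def)
  obtain j where j: "j < Suc k" "v $ j \<noteq> 0"
    using v by (metis carrier_vecD eq_vecI index_zero_vec)
  then have "y $ (m + j) \<noteq> 0" "m + j < n"
    using mk by (auto simp: y_def)
  then have nz: "y \<noteq> 0\<^sub>v n"
    by auto
  have "M *\<^sub>v y = W *\<^sub>v v"
  proof (rule eq_vecI)
    fix i
    assume "i < dim_vec (W *\<^sub>v v)"
    then have i: "i < k"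
      by (simp add: W_def)
    have "(M *\<^sub>v y) $ i = (\<Sum>l<n. M $$ (i, l) * y $ l)"
      using M y i by (auto simp: scalar_prod_def atLeast0LessThan)
    also have "\<dots> = (\<Sum>l\<in>{m..<m + Suc k}. M $$ (i, l) * y $ l)"
      using mk by (intro sum.mono_neutral_right) (auto simp: y_def)
    also have "\<dots> = (\<Sum>l<Suc k. M $$ (i, m + l) * v $ l)"
      using mk by (intro sum.reindex_bij_witness[of _ "\<lambda>l. m + l" "\<lambda>l. l - m"]) (auto simp: y_def)
    also have "\<dots> = (W *\<^sub>v v) $ i"
      using v i by (auto simp: W_def scalar_prod_def atLeast0LessThan simp del: sum.lessThan_Suc)
    finally show "(M *\<^sub>v y) $ i = (W *\<^sub>v v) $ i" .
  qed (use M in \<open>simp add: W_def\<close>)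
  then show ?thesis
    using y nz Wv by (intro exI[of _ y]) (auto simp: y_def split: if_splits)
qed

lemma unitary_plus_rank_carrier:
  "X \<in> unitary_plus_rank n k \<Longrightarrow> X \<in> carrier_mat n n"
  by (auto simp: unitary_plus_rank_def unitary_mats_def)

text \<open>
The vector \<open>y\<close> is chosen so that \<open>x = V y\<close> lies in the kernel of \<open>B\<^sup>*\<close>, where \<open>X = Q + G B\<^sup>*\<close>.
Then \<open>X x = Q x\<close> has the length of \<open>y\<close>, whereas \<open>A x\<close> has the length of \<open>\<Sigma> y\<close>. Both
lower bounds come from this lemma, by placing the block of \<open>k + 1\<close> coordinates at either end.
\<close>

lemma exists_vector_stretch_le_distance:
  assumes U: "U \<in> unitary_mats n" and V: "V \<in> unitary_mats n"
    and X: "X \<in> unitary_plus_rank n k" and mk: "m + k < n"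
  obtains y where "y \<in> carrier_vec n" "0 < euclidean_norm y"
    "\<And>i. i < n \<Longrightarrow> y $ i \<noteq> 0 \<Longrightarrow> m \<le> i \<and> i \<le> m + k"
    "\<bar>euclidean_norm (real_diag n s *\<^sub>v y) - euclidean_norm y\<bar>
       \<le> spectral_norm (U * real_diag n s * mat_adjoint V - X) * euclidean_norm y"
proof -
  note [simp] = unitary_matsD(1)[OF U] unitary_matsD(1)[OF V]
  obtain Q G B where Q: "Q \<in> unitary_mats n" and G [simp]: "G \<in> carrier_mat n k"
    and B [simp]: "B \<in> carrier_mat n k" and X_eq: "X = Q + G * mat_adjoint B"
    using X by (auto simp: unitary_plus_rank_def)
  note [simp] = unitary_matsD(1)[OF Q]
  obtain y where y [simp]: "y \<in> carrier_vec n" and nz: "y \<noteq> 0\<^sub>v n"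
    and ker: "mat_adjoint B * V *\<^sub>v y = 0\<^sub>v k"
    and supp: "\<And>i. i < n \<Longrightarrow> y $ i \<noteq> 0 \<Longrightarrow> m \<le> i \<and> i \<le> m + k"
    using kernel_vector_supported_on_interval[of "mat_adjoint B * V" k n m] mk
    by (auto simp: mult_carrier_mat[of _ k n])
  define x where "x = V *\<^sub>v y"
  have x [simp]: "x \<in> carrier_vec n"
    unfolding x_def by (rule mult_mat_vec_carrier[of _ n n]) simp_all
  have norm_x: "euclidean_norm x = euclidean_norm y"
    unfolding x_def by (rule euclidean_norm_unitary[OF V y])
  let ?S = "real_diag n s"
  define A where "A = U * ?S * mat_adjoint V"
  have A [simp]: "A \<in> carrier_mat n n"
    unfolding A_def by (intro mult_carrier_mat[of _ n n]) simp_all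
  have "mat_adjoint V *\<^sub>v x = mat_adjoint V * V *\<^sub>v y"
    unfolding x_def by (rule assoc_mult_mat_vec[symmetric, of _ n n _ n]) simp_all
  then have Vx: "mat_adjoint V *\<^sub>v x = y"
    by (simp add: unitary_matsD(2)[OF V])
  have "A *\<^sub>v x = U *\<^sub>v (?S *\<^sub>v (mat_adjoint V *\<^sub>v x))"
    by (simp add: A_def assoc_mult_mat_vec[of _ n n _ n] mult_carrier_mat[of _ n n]
        mult_mat_vec_carrier[of _ n n])
  then have "A *\<^sub>v x = U *\<^sub>v (?S *\<^sub>v y)"
    by (simp add: Vx)
  then have Ax: "euclidean_norm (A *\<^sub>v x) = euclidean_norm (?S *\<^sub>v y)"
    by (simp add: euclidean_norm_unitary[OF U] mult_mat_vec_carrier[of _ n n])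
  have "mat_adjoint B *\<^sub>v x = 0\<^sub>v k"
    using ker by (simp add: x_def assoc_mult_mat_vec[of _ k n _ n])
  then have "G * mat_adjoint B *\<^sub>v x = 0\<^sub>v n"
    by (simp add: assoc_mult_mat_vec[of _ n k _ n])
      (intro eq_vecI, auto simp: carrier_matD[OF G])
  then have "X *\<^sub>v x = Q *\<^sub>v x"
    by (simp add: X_eq add_mult_distrib_mat_vec[of _ n n] mult_carrier_mat[of _ n k]
        mult_mat_vec_carrier[of _ n n])
  then have Xx: "euclidean_norm (X *\<^sub>v x) = euclidean_norm y"
    by (simp add: euclidean_norm_unitary[OF Q] norm_x)
  have X' [simp]: "X \<in> carrier_mat n n"
    by (rule unitary_plus_rank_carrier[OF X])
  have "\<bar>euclidean_norm (A *\<^sub>v x) - euclidean_norm (X *\<^sub>v x)\<bar> \<le> euclidean_norm (A *\<^sub>v x - X *\<^sub>v x)"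
    by (rule euclidean_norm_minus[of _ n]) (simp_all add: mult_mat_vec_carrier[of _ n n])
  also have "A *\<^sub>v x - X *\<^sub>v x = (A - X) *\<^sub>v x"
    by (simp add: minus_mult_distrib_mat_vec[of _ n n])
  also have "euclidean_norm ((A - X) *\<^sub>v x) \<le> spectral_norm (A - X) * euclidean_norm x"
    by (rule euclidean_norm_le_spectral_norm[of _ n n]) (simp_all add: minus_carrier_mat)
  also note norm_x
  finally have "\<bar>euclidean_norm (?S *\<^sub>v y) - euclidean_norm y\<bar> \<le> spectral_norm (A - X) * euclidean_norm y"
    by (simp only: Ax Xx)
  then show ?thesis
    unfolding A_def using that y euclidean_norm_pos[OF y nz] supp by blast
qed

lemma distance_unitary_plus_rank_ge:
  assumes svd: "is_svd n A U s V" and k: "k < n" and X: "X \<in> unitary_plus_rank n k"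
  shows "Max {0, s (k + 1) - 1, 1 - s (n - k)} \<le> spectral_norm (A - X)"
proof -
  have U: "U \<in> unitary_mats n" and V: "V \<in> unitary_mats n"
    and A: "A = U * real_diag n s * mat_adjoint V"
    and mono: "\<And>i j. 1 \<le> i \<Longrightarrow> i \<le> j \<Longrightarrow> j \<le> n \<Longrightarrow> s j \<le> s i"
    and nonneg: "\<And>i. 1 \<le> i \<Longrightarrow> i \<le> n \<Longrightarrow> 0 \<le> s i"
    using svd by (auto simp: is_svd_def)
  have "s (k + 1) - 1 \<le> spectral_norm (A - X)"
  proof -
    obtain y where y: "y \<in> carrier_vec n" "0 < euclidean_norm y"
      and supp: "\<And>i. i < n \<Longrightarrow> y $ i \<noteq> 0 \<Longrightarrow> 0 \<le> i \<and> i \<le> 0 + k"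
      and dist: "\<bar>euclidean_norm (real_diag n s *\<^sub>v y) - euclidean_norm y\<bar>
        \<le> spectral_norm (A - X) * euclidean_norm y"
      unfolding A by (rule exists_vector_stretch_le_distance[OF U V X, of 0 s]) (use k in auto)
    have "s (k + 1) * euclidean_norm y \<le> euclidean_norm (real_diag n s *\<^sub>v y)"
    proof (rule euclidean_norm_real_diag_ge[OF y(1)])
      fix i
      assume "i < n" "y $ i \<noteq> 0"
      then have "s (k + 1) \<le> s (Suc i)"
        using supp k by (intro mono) auto
      then show "s (k + 1) \<le> \<bar>s (Suc i)\<bar>"
        by simp
    qed (use k nonneg in auto)
    then have "(s (k + 1) - 1) * euclidean_norm y \<le> spectral_norm (A - X) * euclidean_norm y"
      using dist by (simp add: algebra_simps)
    then show ?thesis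
      using y(2) by (simp add: mult_le_cancel_right)
  qed
  moreover have "1 - s (n - k) \<le> spectral_norm (A - X)"
  proof -
    \<comment> \<open>Coordinates count from 0, so the smallest \<open>k + 1\<close> singular values start at \<open>n - k - 1\<close>.\<close>
    obtain y where y: "y \<in> carrier_vec n" "0 < euclidean_norm y"
      and supp: "\<And>i. i < n \<Longrightarrow> y $ i \<noteq> 0 \<Longrightarrow> n - k - 1 \<le> i \<and> i \<le> n - k - 1 + k"
      and dist: "\<bar>euclidean_norm (real_diag n s *\<^sub>v y) - euclidean_norm y\<bar>
        \<le> spectral_norm (A - X) * euclidean_norm y"
      unfolding A by (rule exists_vector_stretch_le_distance[OF U V X, of "n - k - 1" s]) (use k in auto)
    have "euclidean_norm (real_diag n s *\<^sub>v y) \<le> s (n - k) * euclidean_norm y"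
    proof (rule euclidean_norm_real_diag_le[OF y(1)])
      fix i
      assume i: "i < n" "y $ i \<noteq> 0"
      then have "s (Suc i) \<le> s (n - k)"
        using supp[of i] k by (intro mono) auto
      then show "\<bar>s (Suc i)\<bar> \<le> s (n - k)"
        using nonneg[of "Suc i"] i by simp
    qed (use k nonneg in auto)
    then have "(1 - s (n - k)) * euclidean_norm y \<le> spectral_norm (A - X) * euclidean_norm y"
      using dist by (simp add: algebra_simps)
    then show ?thesis
      using y(2) by (simp add: mult_le_cancel_right)
  qed
  ultimately show ?thesis
    by (simp add: spectral_norm_nonneg)
qed

section \<open>Diagonal matrices that are unitary plus rank k\<close>

text \<open>
Let \<open>x \<ge> 1 \<ge> y \<ge> 0\<close>. Subtracting from \<open>diag(x, y)\<close> the rotation with first row \<open>(c, -s)\<close> and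
second row \<open>(s, c)\<close> leaves a matrix of determinant \<open>x y + 1 - c (x + y)\<close>, so the difference is
singular for \<open>c = (1 + x y) / (x + y)\<close>. In that case it is the product of the column \<open>(p, -q)\<close>
and the row \<open>(p, q)\<close> with \<open>p\<^sup>2 = x - c = (x\<^sup>2 - 1) / (x + y)\<close>,
\<open>q\<^sup>2 = c - y = (1 - y\<^sup>2) / (x + y)\<close> and \<open>s = p q\<close>. The weights below are \<open>p\<close> and \<open>q\<close>.

Replacing \<open>x\<close> by \<open>max 1 x\<close> and \<open>y\<close> by \<open>min 1 y\<close> makes a weight vanish as soon as its entry is
on the wrong side of 1. The same formulas then cover pairs in either order, pairs with both
entries on one side of 1, and an entry paired with itself.
\<close>

definition upper_weight :: "real \<Rightarrow> real \<Rightarrow> real" where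
  "upper_weight x y = sqrt (((max 1 x)\<^sup>2 - 1) / (max 1 x + min 1 y))"

definition lower_weight :: "real \<Rightarrow> real \<Rightarrow> real" where
  "lower_weight x y = sqrt ((1 - (min 1 y)\<^sup>2) / (max 1 x + min 1 y))"

text \<open>
The first row of the rotation is what remains of the first row \<open>(x, 0)\<close> of \<open>diag(x, y)\<close> after the
rank-one corrections belonging to the ordered pairs \<open>(x, y)\<close> and \<open>(y, x)\<close> are both subtracted.
For entries on different sides of 1, at most one of the two corrections is nonzero.
\<close>

definition rotation_cos :: "real \<Rightarrow> real \<Rightarrow> real" where
  "rotation_cos x y = x - (upper_weight x y)\<^sup>2 + (lower_weight y x)\<^sup>2"

definition rotation_sin :: "real \<Rightarrow> real \<Rightarrow> real" where
  "rotation_sin x y = upper_weight y x * lower_weight y x - upper_weight x y * lower_weight x y"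

lemma upper_weight_eq_0: "x \<le> 1 \<Longrightarrow> upper_weight x y = 0"
  by (simp add: upper_weight_def max_def)

lemma lower_weight_eq_0: "1 \<le> y \<Longrightarrow> lower_weight x y = 0"
  by (simp add: lower_weight_def min_def)

lemma upper_weight_squared:
  assumes "0 \<le> y"
  shows "(upper_weight x y)\<^sup>2 = ((max 1 x)\<^sup>2 - 1) / (max 1 x + min 1 y)"
  unfolding upper_weight_def using assms
  by (intro real_sqrt_pow2 divide_nonneg_nonneg) (auto simp: max_def min_def one_le_power)

lemma lower_weight_squared:
  assumes "0 \<le> y"
  shows "(lower_weight x y)\<^sup>2 = (1 - (min 1 y)\<^sup>2) / (max 1 x + min 1 y)"
  unfolding lower_weight_def using assms
  by (intro real_sqrt_pow2 divide_nonneg_nonneg) (auto simp: max_def min_def power_le_one)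

lemma rotation_sin_swap: "rotation_sin y x = - rotation_sin x y"
  by (simp add: rotation_sin_def)

lemma rotation_same_side:
  assumes "0 \<le> x" "0 \<le> y" "1 \<le> x \<and> 1 \<le> y \<or> x \<le> 1 \<and> y \<le> 1"
  shows "rotation_cos x y = 1" "rotation_sin x y = 0"
proof -
  show "rotation_cos x y = 1"
    using assms(3)
  proof
    assume side: "1 \<le> x \<and> 1 \<le> y"
    then have "(upper_weight x y)\<^sup>2 = (x\<^sup>2 - 1) / (x + 1)"
      by (simp add: upper_weight_squared max_absorb2 min_absorb1)
    also have "\<dots> = x - 1"
      using side by (simp add: field_simps power2_eq_square)
    finally show ?thesis
      using side by (simp add: rotation_cos_def lower_weight_eq_0)
  next
    assume side: "x \<le> 1 \<and> y \<le> 1"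
    then have "(lower_weight y x)\<^sup>2 = (1 - x\<^sup>2) / (1 + x)"
      using assms(1) by (simp add: lower_weight_squared max_absorb1 min_absorb2)
    also have "\<dots> = 1 - x"
      using assms(1) by (simp add: field_simps power2_eq_square)
    finally show ?thesis
      using side by (simp add: rotation_cos_def upper_weight_eq_0)
  qed
  show "rotation_sin x y = 0"
    using assms by (auto simp: rotation_sin_def upper_weight_eq_0 lower_weight_eq_0)
qed

lemma rotation_opposite_sides:
  assumes "1 \<le> x" "0 \<le> y" "y \<le> 1"
  shows "rotation_cos x y = (1 + x * y) / (x + y)" "rotation_cos y x = (1 + x * y) / (x + y)"
    "(rotation_cos x y)\<^sup>2 + (rotation_sin x y)\<^sup>2 = 1"
proof -
  have pos: "0 < x + y"
    using assms by simp
  have up: "(upper_weight x y)\<^sup>2 = (x\<^sup>2 - 1) / (x + y)" "upper_weight y x = 0"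
    and low: "(lower_weight x y)\<^sup>2 = (1 - y\<^sup>2) / (x + y)" "lower_weight y x = 0"
    using assms by (simp_all add: upper_weight_squared lower_weight_squared max_absorb2
        min_absorb2 upper_weight_eq_0 lower_weight_eq_0)
  show c: "rotation_cos x y = (1 + x * y) / (x + y)"
  proof -
    have "rotation_cos x y = x - (x\<^sup>2 - 1) / (x + y)"
      by (simp add: rotation_cos_def up low)
    also have "\<dots> = (1 + x * y) / (x + y)"
      using pos by (simp add: field_simps power2_eq_square)
    finally show ?thesis .
  qed
  show "rotation_cos y x = (1 + x * y) / (x + y)"
  proof -
    have "rotation_cos y x = y + (1 - y\<^sup>2) / (x + y)"
      by (simp add: rotation_cos_def up low)
    also have "\<dots> = (1 + x * y) / (x + y)"
      using pos by (simp add: field_simps power2_eq_square)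
    finally show ?thesis .
  qed
  have "(rotation_sin x y)\<^sup>2 = (x\<^sup>2 - 1) / (x + y) * ((1 - y\<^sup>2) / (x + y))"
    by (simp add: rotation_sin_def up low power_mult_distrib)
  then have "(rotation_cos x y)\<^sup>2 + (rotation_sin x y)\<^sup>2
      = ((1 + x * y)\<^sup>2 + (x\<^sup>2 - 1) * (1 - y\<^sup>2)) / (x + y)\<^sup>2"
    by (simp add: c power_divide power2_eq_square flip: add_divide_distrib)
  also have "(1 + x * y)\<^sup>2 + (x\<^sup>2 - 1) * (1 - y\<^sup>2) = (x + y)\<^sup>2"
    by (simp add: power2_eq_square algebra_simps)
  finally show "(rotation_cos x y)\<^sup>2 + (rotation_sin x y)\<^sup>2 = 1"
    using pos by simp
qed

lemma rotation_cos_swap: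
  assumes "0 \<le> x" "0 \<le> y"
  shows "rotation_cos y x = rotation_cos x y"
proof -
  consider "1 \<le> x \<and> 1 \<le> y \<or> x \<le> 1 \<and> y \<le> 1" | "1 \<le> x" "y \<le> 1" | "1 \<le> y" "x \<le> 1"
    by linarith
  then show ?thesis
    using assms rotation_same_side[of x y] rotation_same_side[of y x]
      rotation_opposite_sides(1,2)[of x y] rotation_opposite_sides(1,2)[of y x]
    by cases auto
qed

lemma rotation_cos_sin:
  assumes "0 \<le> x" "0 \<le> y"
  shows "(rotation_cos x y)\<^sup>2 + (rotation_sin x y)\<^sup>2 = 1"
proof -
  consider "1 \<le> x \<and> 1 \<le> y \<or> x \<le> 1 \<and> y \<le> 1" | "1 \<le> x" "y \<le> 1" | "1 \<le> y" "x \<le> 1"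
    by linarith
  then show ?thesis
    using assms rotation_same_side[of x y] rotation_opposite_sides(3)[of x y]
      rotation_opposite_sides(3)[of y x] rotation_cos_swap[of x y] rotation_sin_swap[of x y]
    by cases auto
qed

text \<open>
Position \<open>i\<close> is paired with its mirror image \<open>r i\<close>, and column \<open>j\<close> of \<open>G\<close> and of \<open>B\<close> holds the
rank-one correction for the ordered pair \<open>(j, r j)\<close>. The assumptions \<open>upper\<close> and \<open>lower\<close> say
exactly that both weights of this pair vanish for \<open>j \<ge> k\<close>, so \<open>k\<close> columns suffice. What remains
is the matrix \<open>Q\<close>, with the values \<open>c i\<close> on the diagonal and \<open>t i\<close> on the antidiagonal; it is
orthogonal because \<open>c\<close> is invariant under \<open>r\<close>, \<open>t\<close> changes sign under \<open>r\<close>, and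
\<open>c\<^sup>2 + t\<^sup>2 = 1\<close>.
\<close>

lemma real_diag_in_unitary_plus_rank:
  assumes k: "k \<le> n" and nonneg: "\<And>i. i \<in> {1..n} \<Longrightarrow> 0 \<le> s i"
    and upper: "\<And>i. i \<in> {k + 1..n} \<Longrightarrow> s i \<le> 1"
    and lower: "\<And>i. i \<in> {1..n - k} \<Longrightarrow> 1 \<le> s i"
  shows "real_diag n s \<in> unitary_plus_rank n k"
proof -
  define r where "r i = n - 1 - i" for i
  have r: "r i < n" "r (r i) = i" if "i < n" for i
    using that by (auto simp: r_def)
  have r_eq: "l = r i \<longleftrightarrow> i = r l" if "i < n" "l < n" for i l
    using that by (auto simp: r_def)
  have r_inj: "r i = r l \<longleftrightarrow> i = l" if "i < n" "l < n" for i l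
    using that by (auto simp: r_def)
  define d where "d i = s (Suc i)" for i
  have d: "0 \<le> d i" if "i < n" for i
    using that nonneg by (simp add: d_def)
  define p where "p i = upper_weight (d i) (d (r i))" for i
  define q where "q i = lower_weight (d i) (d (r i))" for i
  have p0: "p i = 0" if "i < n" "k \<le> i" for i
    using that upper[of "Suc i"] by (simp add: p_def d_def upper_weight_eq_0)
  have q0: "q i = 0" if "i < n" "k \<le> i" for i
    using that lower[of "Suc (r i)"] by (simp add: q_def d_def lower_weight_eq_0 r_def)
  define c where "c i = rotation_cos (d i) (d (r i))" for i
  define t where "t i = rotation_sin (d i) (d (r i))" for i
  have c_eq: "c i = d i - (p i)\<^sup>2 + (q (r i))\<^sup>2" if "i < n" for i
    using r that by (simp add: c_def p_def q_def rotation_cos_def)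
  have t_eq: "t i = p (r i) * q (r i) - p i * q i" if "i < n" for i
    using r that by (simp add: t_def p_def q_def rotation_sin_def)
  have c_r: "c (r i) = c i" if "i < n" for i
    using r that d by (simp add: c_def rotation_cos_swap)
  have t_r: "t (r i) = - t i" if "i < n" for i
    using r that by (simp add: t_def rotation_sin_swap[of "d (r i)" "d i"])
  have ct: "c i * c i + t i * t i = 1" if "i < n" for i
    using r that d rotation_cos_sin[of "d i" "d (r i)"] by (simp add: c_def t_def power2_eq_square)

  define Qe where "Qe i l = (if i = l then c i else 0) + (if l = r i then t i else 0)" for i l
  define Ge where "Ge i j = (if j = i then p i else 0) - (if j = r i then q j else 0)" for i j
  define Be where "Be i j = (if j = i then p i else 0) + (if j = r i then q j else 0)" for i j
  define Q where "Q = Matrix.mat n n (\<lambda>(i, l). complex_of_real (Qe i l))"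
  define G where "G = Matrix.mat n k (\<lambda>(i, j). complex_of_real (Ge i j))"
  define B where "B = Matrix.mat n k (\<lambda>(i, j). complex_of_real (Be i j))"
  have Q: "Q \<in> unitary_mats n"
  proof (rule unitary_matsI)
    show "Q \<in> carrier_mat n n"
      by (simp add: Q_def)
    show "mat_adjoint Q * Q = 1\<^sub>m n"
    proof (rule eq_matI)
      fix i l
      assume "i < dim_row (1\<^sub>m n)" "l < dim_col (1\<^sub>m n)"
      then have il: "i < n" "l < n"
        by auto
      have "(mat_adjoint Q * Q) $$ (i, l) = (\<Sum>m<n. cnj (Q $$ (m, i)) * Q $$ (m, l))"
        using il by (simp add: Q_def scalar_prod_def atLeast0LessThan)
      also have "\<dots> = complex_of_real (\<Sum>m<n. Qe m i * Qe m l)"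
        using il by (simp add: Q_def)
      also have "(\<Sum>m<n. Qe m i * Qe m l)
          = (\<Sum>m<n. (if m = i then c m * Qe m l else 0) + (if m = r i then t m * Qe m l else 0))"
      proof (rule sum.cong)
        fix m
        assume "m \<in> {..<n}"
        then have "i = r m \<longleftrightarrow> m = r i"
          using r_eq il by simp
        then have "Qe m i = (if m = i then c m else 0) + (if m = r i then t m else 0)"
          by (simp only: Qe_def)
        then show "Qe m i * Qe m l = (if m = i then c m * Qe m l else 0) + (if m = r i then t m * Qe m l else 0)"
          by (simp only: distrib_right if_distrib[of "\<lambda>a. a * Qe m l"] mult_zero_left)
      qed simp
      also have "\<dots> = c i * Qe i l + t (r i) * Qe (r i) l"
        using il r by (simp add: sum.distrib)
      also have "\<dots> = (if i = l then c i * c i + t i * t i else 0)"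
        using il r c_r t_r by (auto simp: Qe_def algebra_simps)
      finally show "(mat_adjoint Q * Q) $$ (i, l) = 1\<^sub>m n $$ (i, l)"
        using il ct by auto
    qed (auto simp: Q_def)
  qed
  have "real_diag n s = Q + G * mat_adjoint B"
  proof (rule eq_matI)
    fix i l
    assume "i < dim_row (Q + G * mat_adjoint B)" "l < dim_col (Q + G * mat_adjoint B)"
    then have il: "i < n" "l < n"
      by (auto simp: G_def B_def)
    have Be0: "Be l j = 0" if "k \<le> j" "j < n" for j
      using that p0 q0 il by (auto simp: Be_def)
    have "(G * mat_adjoint B) $$ (i, l) = (\<Sum>j<k. G $$ (i, j) * cnj (B $$ (l, j)))"
      using il by (simp add: G_def B_def scalar_prod_def atLeast0LessThan)
    also have "\<dots> = complex_of_real (\<Sum>j<k. Ge i j * Be l j)"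
      using il by (simp add: G_def B_def)
    \<comment> \<open>The sum is extended to all positions, since the single terms that survive sit at \<open>i\<close> and \<open>r i\<close>.\<close>
    also have "(\<Sum>j<k. Ge i j * Be l j) = (\<Sum>j<n. Ge i j * Be l j)"
      using k Be0 by (intro sum.mono_neutral_left) auto
    also have "\<dots> = (\<Sum>j<n. (if j = i then p i * Be l j else 0) - (if j = r i then q j * Be l j else 0))"
      by (intro sum.cong) (simp_all add: Ge_def left_diff_distrib)
    also have "\<dots> = p i * Be l i - q (r i) * Be l (r i)"
      using il r by (simp add: sum_subtractf)
    also have "\<dots> = (if i = l then d i - c i else 0) - (if l = r i then t i else 0)"
      using il r r_eq[OF il(2,1)] r_inj[OF il] c_eq t_eq
      by (auto simp: Be_def power2_eq_square algebra_simps)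
    finally have "(G * mat_adjoint B) $$ (i, l)
        = complex_of_real ((if i = l then d i - c i else 0) - (if l = r i then t i else 0))" .
    then show "real_diag n s $$ (i, l) = (Q + G * mat_adjoint B) $$ (i, l)"
      using il by (auto simp: Q_def Qe_def G_def B_def d_def)
  qed (auto simp: G_def B_def carrier_matD[OF real_diag_carrier])
  moreover have "G \<in> carrier_mat n k" "B \<in> carrier_mat n k"
    by (auto simp: G_def B_def)
  ultimately show ?thesis
    using Q unfolding unitary_plus_rank_def by blast
qed

lemma unitary_plus_rank_unitary_mult:
  assumes U: "U \<in> unitary_mats n" and V: "V \<in> unitary_mats n" and X: "X \<in> unitary_plus_rank n k"
  shows "U * X * mat_adjoint V \<in> unitary_plus_rank n k"
proof -
  note [simp] = unitary_matsD(1)[OF U] unitary_matsD(1)[OF V]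
  obtain Q G B where Q: "Q \<in> unitary_mats n" and G [simp]: "G \<in> carrier_mat n k"
    and B [simp]: "B \<in> carrier_mat n k" and X_eq: "X = Q + G * mat_adjoint B"
    using X by (auto simp: unitary_plus_rank_def)
  note [simp] = unitary_matsD(1)[OF Q]
  have "U * X = U * Q + U * (G * mat_adjoint B)"
    unfolding X_eq by (rule mult_add_distrib_mat[of _ n n _ n]) (simp_all add: mult_carrier_mat[of _ n k])
  then have "U * X * mat_adjoint V = (U * Q + U * (G * mat_adjoint B)) * mat_adjoint V"
    by simp
  also have "\<dots> = U * Q * mat_adjoint V + U * (G * mat_adjoint B) * mat_adjoint V"
    by (rule add_mult_distrib_mat[of _ n n _ _ n])
      (simp_all add: mult_carrier_mat[of _ n n] mult_carrier_mat[of _ n k])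
  also have "U * (G * mat_adjoint B) * mat_adjoint V = U * G * (mat_adjoint B * mat_adjoint V)"
  proof -
    have "U * (G * mat_adjoint B) = U * G * mat_adjoint B"
      by (rule assoc_mult_mat[symmetric, of _ n n _ k _ n]) simp_all
    moreover have "U * G * mat_adjoint B * mat_adjoint V = U * G * (mat_adjoint B * mat_adjoint V)"
      by (rule assoc_mult_mat[of _ n k _ n _ n]) (simp_all add: mult_carrier_mat[of _ n n])
    ultimately show ?thesis
      by simp
  qed
  also have "mat_adjoint B * mat_adjoint V = mat_adjoint (V * B)"
    by (simp add: mat_adjoint_mult[of _ n n _ k])
  finally have "U * X * mat_adjoint V = U * Q * mat_adjoint V + U * G * mat_adjoint (V * B)" .
  moreover have "U * Q * mat_adjoint V \<in> unitary_mats n"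
    by (intro unitary_mats_mult U Q V mat_adjoint_unitary)
  moreover have "U * G \<in> carrier_mat n k" "V * B \<in> carrier_mat n k"
    by (auto intro: mult_carrier_mat[of _ n n])
  ultimately show ?thesis
    unfolding unitary_plus_rank_def by blast
qed

section \<open>The clipped singular values\<close>

text \<open>
For a decreasing sequence the counts in the definition of clipping are positions: the entries above
1 form an initial segment and the entries below 1 a final one.
\<close>

lemma num_above_one_ge_iff:
  assumes mono: "\<And>i j. 1 \<le> i \<Longrightarrow> i \<le> j \<Longrightarrow> j \<le> n \<Longrightarrow> s j \<le> s i" and i: "i \<in> {1..n}"
  shows "i \<le> num_above_one n s \<longleftrightarrow> 1 < s i"
proof
  assume "1 < s i"
  then have "{1..i} \<subseteq> {j \<in> {1..n}. 1 < s j}"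
    using i mono by fastforce
  then have "card {1..i} \<le> num_above_one n s"
    unfolding num_above_one_def by (intro card_mono) auto
  then show "i \<le> num_above_one n s"
    by simp
next
  assume le: "i \<le> num_above_one n s"
  show "1 < s i"
  proof (rule ccontr)
    assume "\<not> 1 < s i"
    then have "j < i" if "j \<in> {1..n}" "1 < s j" for j
      using mono[of i j] i that by (cases "j < i") auto
    then have "{j \<in> {1..n}. 1 < s j} \<subseteq> {1..<i}"
      by auto
    then have "num_above_one n s \<le> card {1..<i}"
      unfolding num_above_one_def by (intro card_mono) auto
    then show False
      using le i by (simp; linarith)
  qed
qed

lemma num_below_one_less_iff:
  assumes mono: "\<And>i j. 1 \<le> i \<Longrightarrow> i \<le> j \<Longrightarrow> j \<le> n \<Longrightarrow> s j \<le> s i" and i: "i \<in> {1..n}"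
  shows "n - num_below_one n s < i \<longleftrightarrow> s i < 1"
proof
  assume "s i < 1"
  then have "{i..n} \<subseteq> {j \<in> {1..n}. s j < 1}"
    using i mono by fastforce
  then have "card {i..n} \<le> num_below_one n s"
    unfolding num_below_one_def by (intro card_mono) auto
  then show "n - num_below_one n s < i"
    using i by (simp; linarith)
next
  assume le: "n - num_below_one n s < i"
  show "s i < 1"
  proof (rule ccontr)
    assume "\<not> s i < 1"
    then have "i < j" if "j \<in> {1..n}" "s j < 1" for j
      using mono[of j i] i that by (cases "i < j") auto
    then have "{j \<in> {1..n}. s j < 1} \<subseteq> {i<..n}"
      by auto
    then have "num_below_one n s \<le> card {i<..n}"
      unfolding num_below_one_def by (intro card_mono) auto
    then show False
      using le i by simp
  qed
qed

lemma clipped_eq: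
  assumes mono: "\<And>i j. 1 \<le> i \<Longrightarrow> i \<le> j \<Longrightarrow> j \<le> n \<Longrightarrow> s j \<le> s i" and i: "i \<in> {1..n}"
  shows "clipped n k s i = (if k < i \<and> 1 < s i \<or> i \<le> n - k \<and> s i < 1 then 1 else s i)"
proof -
  have "i \<le> num_above_one n s \<longleftrightarrow> 1 < s i"
    by (rule num_above_one_ge_iff[OF _ i], rule mono)
  moreover have "n - num_below_one n s < i \<longleftrightarrow> s i < 1"
    by (rule num_below_one_less_iff[OF _ i], rule mono)
  ultimately show ?thesis
    by (auto simp: clipped_def)
qed

theorem theorem7:
  fixes A U V Ahat :: "complex mat" and \<sigma> :: "nat \<Rightarrow> real" and n k :: nat
  assumes "A \<in> carrier_mat n n"
    and "is_svd n A U \<sigma> V"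
    and "k < n"
    and "Ahat = U * real_diag n (clipped n k \<sigma>) * mat_adjoint V"
  shows "is_arg_min (\<lambda>X. spectral_norm (A - X)) (\<lambda>X. X \<in> unitary_plus_rank n k) Ahat \<and>
         (INF X\<in>unitary_plus_rank n k. spectral_norm (A - X)) = spectral_norm (A - Ahat) \<and>
         spectral_norm (A - Ahat) = Max {0, \<sigma> (k + 1) - 1, 1 - \<sigma> (n - k)}"
proof -
  have U: "U \<in> unitary_mats n" and V: "V \<in> unitary_mats n"
    and A: "A = U * real_diag n \<sigma> * mat_adjoint V"
    and mono: "\<And>i j. 1 \<le> i \<Longrightarrow> i \<le> j \<Longrightarrow> j \<le> n \<Longrightarrow> \<sigma> j \<le> \<sigma> i"
    and nonneg: "\<And>i. i \<in> {1..n} \<Longrightarrow> 0 \<le> \<sigma> i"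
    using assms(2) by (auto simp: is_svd_def)
  note [simp] = unitary_matsD(1)[OF U] unitary_matsD(1)[OF V]
  let ?M = "Max {0, \<sigma> (k + 1) - 1, 1 - \<sigma> (n - k)}"
  have clipped: "clipped n k \<sigma> i = (if k < i \<and> 1 < \<sigma> i \<or> i \<le> n - k \<and> \<sigma> i < 1 then 1 else \<sigma> i)"
    if "i \<in> {1..n}" for i
    by (rule clipped_eq[OF _ that], rule mono)
  have "real_diag n (clipped n k \<sigma>) \<in> unitary_plus_rank n k"
    using assms(3) nonneg by (intro real_diag_in_unitary_plus_rank) (auto simp: clipped)
  then have mem: "Ahat \<in> unitary_plus_rank n k"
    unfolding assms(4) by (rule unitary_plus_rank_unitary_mult[OF U V])
  have lower: "?M \<le> spectral_norm (A - X)" if "X \<in> unitary_plus_rank n k" for X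
    by (rule distance_unitary_plus_rank_ge[OF assms(2,3) that])
  have diff: "A - Ahat = U * real_diag n (\<lambda>i. \<sigma> i - clipped n k \<sigma> i) * mat_adjoint V"
  proof -
    let ?S = "real_diag n \<sigma>" and ?T = "real_diag n (clipped n k \<sigma>)"
    have "U * (?S - ?T) * mat_adjoint V = (U * ?S - U * ?T) * mat_adjoint V"
      by (simp add: mult_minus_distrib_mat[of _ n n _ n])
    also have "\<dots> = U * ?S * mat_adjoint V - U * ?T * mat_adjoint V"
      by (rule minus_mult_distrib_mat[of _ n n _ _ n]) (simp_all add: mult_carrier_mat[of _ n n])
    finally show ?thesis
      by (simp add: A assms(4) real_diag_diff)
  qed
  have "spectral_norm (A - Ahat) \<le> ?M"
    unfolding diff
  proof (rule spectral_norm_unitary_real_diag_le[OF U V])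
    fix i
    assume i: "i \<in> {1..n}"
    have "\<sigma> i \<le> \<sigma> (k + 1)" if "k < i"
      using that i by (intro mono) auto
    moreover have "\<sigma> (n - k) \<le> \<sigma> i" if "i \<le> n - k"
      using that i assms(3) by (intro mono) auto
    ultimately show "\<bar>\<sigma> i - clipped n k \<sigma> i\<bar> \<le> ?M"
      using i by (auto simp: clipped le_max_iff_disj)
  qed simp
  with lower[OF mem] have eq: "spectral_norm (A - Ahat) = ?M"
    by (rule antisym[rotated])
  have min: "spectral_norm (A - Ahat) \<le> spectral_norm (A - X)" if "X \<in> unitary_plus_rank n k" for X
    using lower[OF that] eq by simp
  have "(INF X\<in>unitary_plus_rank n k. spectral_norm (A - X)) = spectral_norm (A - Ahat)"
    using mem min by (intro cInf_eq_minimum) auto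
  moreover have "is_arg_min (\<lambda>X. spectral_norm (A - X)) (\<lambda>X. X \<in> unitary_plus_rank n k) Ahat"
    using mem min by (auto simp: is_arg_min_def not_less)
  ultimately show ?thesis
    using eq by blast
qed

end
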